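(* Assume that $S:\mathbb{R}^n\to\mathbb{R}^n$ is $\delta$-contractive with $\delta\in[0,1)$ and $\bar\alpha\in(0,1)$. Then every sequence generated by the line search iteration (with nominal step length $\bar\alpha$) satisfies $$\|r^{k+1}\|_2\le(1-\bar\alpha+\bar\alpha\delta)\|r^k\|_2$$ for all iterations $k$.
   Context: $\|\cdot\|_2$ is the Euclidean norm on $\mathbb{R}^n$. $S$ is $\delta$-contractive if $\|Sx-Sy\|_2\le\delta\|x-y\|_2$ for all $x,y\in\mathbb{R}^n$. Line search iteration: fix algorithm parameters $\bar\alpha\in(0,1)$ (nominal step length), $\epsilon\in(0,1)$ and $\alpha^{\max}\ge\bar\alpha$, and an arbitrary starting point $x^0\in\mathbb{R}^n$. For $k=0,1,2,\dots$ set $$r^k:=Sx^k-x^k,\qquad \bar x^k:=x^k+\bar\alpha r^k,\qquad \bar r^k:=S\bar x^k-\bar x^k,\qquad x^{k+1}:=x^k+\alpha_k r^k,$$ where for each $k$ the step length $\alpha_k$ satisfies: either $\alpha_k=\bar\alpha$, or $\alpha_k\in(\bar\alpha,\alpha^{\max}]$ is such that the line search test $\|r^{k+1}\|_2=\|Sx^{k+1}-x^{k+1}\|_2\le(1-\epsilon)\|\bar r^k\|_2$ holds. The choice of $\alpha_k$ is otherwise arbitrary. *)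

theory Defs
  imports "HOL-Analysis.Analysis"
begin

definition residual :: "(real ^ 'n \<Rightarrow> real ^ 'n) \<Rightarrow> real ^ 'n \<Rightarrow> real ^ 'n" where
  "residual S y = S y - y"

text \<open>
  The argument \<open>\<alpha>\<close> is the sequence of step lengths and \<open>x\<close> the sequence of iterates. The
  predicate is a relation rather than a recursive function because the choice of each
  step length is nondeterministic. When the step length exceeds the nominal
  one, the test compares the residual at the new iterate with the residual at the nominal iterate.
\<close>

definition line_search_iteration ::
  "(real ^ 'n \<Rightarrow> real ^ 'n) \<Rightarrow> real \<Rightarrow> real \<Rightarrow> real \<Rightarrow> (nat \<Rightarrow> real) \<Rightarrow> (nat \<Rightarrow> real ^ 'n) \<Rightarrow> bool"
where
  "line_search_iteration S \<alpha>nom \<epsilon> \<alpha>max \<alpha> x \<longleftrightarrow>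
    (\<forall>k. x (Suc k) = x k + \<alpha> k *\<^sub>R residual S (x k) \<and>
         (\<alpha> k = \<alpha>nom \<or>
          \<alpha> k \<in> {\<alpha>nom<..\<alpha>max} \<and>
          norm (residual S (x (Suc k)))
            \<le> (1 - \<epsilon>) * norm (residual S (x k + \<alpha>nom *\<^sub>R residual S (x k)))))"

end

theory Submission
  imports Defs
begin

text \<open>
  A damped step from \<open>y\<close> to \<open>z = y + a r\<close> with \<open>r = S y - y\<close> leaves the residual
  \<open>S z - z = (S z - S y) + (1 - a) r\<close>: the damping removes the fraction \<open>a\<close> of the old
  residual, and the contraction bounds the new contribution by \<open>\<delta> a \<parallel>r\<parallel>\<close>. This is the claimed
  rate for the nominal step length. A longer step is taken only if its residual is bounded by that
  of the nominal iterate, so it inherits the same rate.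
\<close>

text \<open>
  The triangle inequality is applied after splitting off \<open>S y\<close>, the remaining terms being
  collinear with the old residual; \<open>a \<le> 1\<close> makes their coefficient \<open>1 - a\<close> nonnegative.
\<close>

lemma norm_residual_damped_step_le:
  fixes S :: "real ^ 'n \<Rightarrow> real ^ 'n"
  assumes lip: "\<delta>-lipschitz_on UNIV S" and a: "0 \<le> a" "a \<le> 1"
  shows "norm (residual S (y + a *\<^sub>R residual S y)) \<le> (1 - a + a * \<delta>) * norm (residual S y)"
proof -
  let ?r = "residual S y"
  let ?z = "y + a *\<^sub>R ?r"
  have "residual S ?z = (S ?z - S y) + (1 - a) *\<^sub>R ?r"
    by (simp add: residual_def algebra_simps)
  then have "norm (residual S ?z) \<le> norm (S ?z - S y) + norm ((1 - a) *\<^sub>R ?r)"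
    by (metis norm_triangle_ineq)
  also have "norm (S ?z - S y) \<le> \<delta> * (a * norm ?r)"
    using lipschitz_onD[OF lip, of ?z y] a by (simp add: dist_norm)
  also have "norm ((1 - a) *\<^sub>R ?r) = (1 - a) * norm ?r"
    using a by simp
  finally show ?thesis
    by (simp add: algebra_simps)
qed

theorem theorem5:
  fixes S :: "real ^ 'n \<Rightarrow> real ^ 'n"
    and \<delta> \<alpha>nom \<epsilon> \<alpha>max :: real
    and \<alpha> :: "nat \<Rightarrow> real"
    and x :: "nat \<Rightarrow> real ^ 'n"
  assumes "0 \<le> \<delta>" and "\<delta> < 1"
    and "\<delta>-lipschitz_on UNIV S"
    and "0 < \<alpha>nom" and "\<alpha>nom < 1"
    and "0 < \<epsilon>" and "\<epsilon> < 1"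
    and "\<alpha>nom \<le> \<alpha>max"
    and "line_search_iteration S \<alpha>nom \<epsilon> \<alpha>max \<alpha> x"
  shows "\<forall>k. norm (residual S (x (Suc k)))
               \<le> (1 - \<alpha>nom + \<alpha>nom * \<delta>) * norm (residual S (x k))"
proof
  fix k
  let ?nom = "norm (residual S (x k + \<alpha>nom *\<^sub>R residual S (x k)))"
  have step: "x (Suc k) = x k + \<alpha> k *\<^sub>R residual S (x k)"
    and choice: "\<alpha> k = \<alpha>nom \<or> norm (residual S (x (Suc k))) \<le> (1 - \<epsilon>) * ?nom"
    using assms(9) unfolding line_search_iteration_def by blast+
  have "(1 - \<epsilon>) * ?nom \<le> ?nom"
    using \<open>0 < \<epsilon>\<close> by (simp add: mult_left_le_one_le \<open>\<epsilon> < 1\<close> less_imp_le)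
  with choice step have "norm (residual S (x (Suc k))) \<le> ?nom"
    by auto
  also have "\<dots> \<le> (1 - \<alpha>nom + \<alpha>nom * \<delta>) * norm (residual S (x k))"
    using assms(3-5) by (intro norm_residual_damped_step_le) auto
  finally show "norm (residual S (x (Suc k)))
      \<le> (1 - \<alpha>nom + \<alpha>nom * \<delta>) * norm (residual S (x k))" .
qed

end
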